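(* Let $\Sigma=\{a,b\}$. A word $w\in\Sigma^*$ is a bispecial Sturmian word if and only if there exist letters $x,y\in\Sigma$ such that $xwy$ is a Christoffel word. Equivalently, the set of bispecial Sturmian words equals $\{w\in\Sigma^* \mid xwy \text{ is a Christoffel word for some } x,y\in\Sigma\}$.
   Context: Words are finite and over the alphabet $\Sigma=\{a,b\}$; $|u|_a$ is the number of occurrences of the letter $a$ in $u$; a factor is a contiguous subword; $w[i]$ is the $i$-th letter of $w$ ($1\le i\le |w|$). The empty word is allowed. A word $w\in\Sigma^*$ is Sturmian if it is balanced: for any two factors $u,v$ of $w$ of the same length, $\big||u|_a-|v|_a\big|\le 1$. Let $St$ be the set of (finite) Sturmian words. A word $w\in St$ is left special if $aw,bw\in St$, right special if $wa,wb\in St$, and bispecial if it is both left and right special. Christoffel words: for integers $p,q>0$ with $n=p+q$, the lower Christoffel word $w_{p,q}$ is the word of length $n$ defined for $1\le i\le n$ by $w_{p,q}[i]=a$ if $(iq \bmod n)>((i-1)q \bmod n)$ and $w_{p,q}[i]=b$ if $(iq \bmod n)<((i-1)q \bmod n)$. The upper Christoffel word $w'_{p,q}$ is the word of length $n$ defined by $w'_{p,q}[i]=a$ if $(ip \bmod n)<((i-1)p \bmod n)$ and $w'_{p,q}[i]=b$ if $(ip \bmod n)>((i-1)p \bmod n)$. A Christoffel word is a lower or an upper Christoffel word; $p$ and $q$ are not required to be coprime. *)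

theory Defs
  imports Main "HOL-Library.Sublist"
begin

datatype letter = LA | LB

type_synonym word = "letter list"

definition balanced :: "word \<Rightarrow> bool" where
  "balanced w \<longleftrightarrow>
     (\<forall>u v. sublist u w \<longrightarrow> sublist v w \<longrightarrow> length u = length v \<longrightarrow>
        \<bar>int (count_list u LA) - int (count_list v LA)\<bar> \<le> 1)"

definition St :: "word set" where
  "St = {w. balanced w}"

definition left_special :: "word \<Rightarrow> bool" where
  "left_special w \<longleftrightarrow> w \<in> St \<and> LA # w \<in> St \<and> LB # w \<in> St"

definition right_special :: "word \<Rightarrow> bool" where
  "right_special w \<longleftrightarrow> w \<in> St \<and> w @ [LA] \<in> St \<and> w @ [LB] \<in> St"

definition bispecial :: "word \<Rightarrow> bool" where
  "bispecial w \<longleftrightarrow> left_special w \<and> right_special w"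

(* The letter at the 1-based position i is the entry i - 1 of the list. For p, q > 0 the two
   residues compared at a position always differ, so "else" is the opposite strict inequality;
   see lower_christoffel_nth and upper_christoffel_nth below. *)

definition lower_christoffel :: "nat \<Rightarrow> nat \<Rightarrow> word" where
  "lower_christoffel p q =
     map (\<lambda>i. if (i * q) mod (p + q) > ((i - 1) * q) mod (p + q) then LA else LB) [1..<p + q + 1]"

definition upper_christoffel :: "nat \<Rightarrow> nat \<Rightarrow> word" where
  "upper_christoffel p q =
     map (\<lambda>i. if (i * p) mod (p + q) < ((i - 1) * p) mod (p + q) then LA else LB) [1..<p + q + 1]"

(* p and q need not be coprime. *)
definition christoffel :: "word \<Rightarrow> bool" where
  "christoffel w \<longleftrightarrow>
     (\<exists>p q. p > 0 \<and> q > 0 \<and> (w = lower_christoffel p q \<or> w = upper_christoffel p q))"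

lemma length_christoffel [simp]:
  "length (lower_christoffel p q) = p + q" "length (upper_christoffel p q) = p + q"
  by (simp_all add: lower_christoffel_def upper_christoffel_def del: upt_Suc)

lemma consecutive_residues_differ:
  fixes i r n :: nat
  assumes "0 < r" "r < n" "1 \<le> i"
  shows "(i * r) mod n \<noteq> ((i - 1) * r) mod n"
proof
  assume eq: "(i * r) mod n = ((i - 1) * r) mod n"
  have "i * r = (i - 1) * r + r"
    using assms(3) by (cases i) auto
  then have "n dvd r"
    using eq by (metis diff_add_inverse le_add1 mod_eq_dvd_iff_nat)
  then show False
    using assms(1,2) by (auto dest: dvd_imp_le)
qed

lemma lower_christoffel_nth:
  assumes "p > 0" "q > 0" "1 \<le> i" "i \<le> p + q"
  shows "lower_christoffel p q ! (i - 1) = LA \<longleftrightarrow> (i * q) mod (p + q) > ((i - 1) * q) mod (p + q)"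
    and "lower_christoffel p q ! (i - 1) = LB \<longleftrightarrow> (i * q) mod (p + q) < ((i - 1) * q) mod (p + q)"
proof -
  have *: "lower_christoffel p q ! (i - 1) =
      (if (i * q) mod (p + q) > ((i - 1) * q) mod (p + q) then LA else LB)"
    using assms(3,4) by (simp add: lower_christoffel_def del: upt_Suc)
  have "(i * q) mod (p + q) \<noteq> ((i - 1) * q) mod (p + q)"
    using consecutive_residues_differ[of q "p + q" i] assms by simp
  then show "lower_christoffel p q ! (i - 1) = LA \<longleftrightarrow> (i * q) mod (p + q) > ((i - 1) * q) mod (p + q)"
    and "lower_christoffel p q ! (i - 1) = LB \<longleftrightarrow> (i * q) mod (p + q) < ((i - 1) * q) mod (p + q)"
    unfolding * by auto
qed

lemma upper_christoffel_nth:
  assumes "p > 0" "q > 0" "1 \<le> i" "i \<le> p + q"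
  shows "upper_christoffel p q ! (i - 1) = LA \<longleftrightarrow> (i * p) mod (p + q) < ((i - 1) * p) mod (p + q)"
    and "upper_christoffel p q ! (i - 1) = LB \<longleftrightarrow> (i * p) mod (p + q) > ((i - 1) * p) mod (p + q)"
proof -
  have *: "upper_christoffel p q ! (i - 1) =
      (if (i * p) mod (p + q) < ((i - 1) * p) mod (p + q) then LA else LB)"
    using assms(3,4) by (simp add: upper_christoffel_def del: upt_Suc)
  have "(i * p) mod (p + q) \<noteq> ((i - 1) * p) mod (p + q)"
    using consecutive_residues_differ[of p "p + q" i] assms by simp
  then show "upper_christoffel p q ! (i - 1) = LA \<longleftrightarrow> (i * p) mod (p + q) < ((i - 1) * p) mod (p + q)"
    and "upper_christoffel p q ! (i - 1) = LB \<longleftrightarrow> (i * p) mod (p + q) > ((i - 1) * p) mod (p + q)"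
    unfolding * by auto
qed

end

theory Submission
  imports Defs
begin

text \<open>
  Let \<open>n = |w| + 2\<close>, let \<open>q\<close> be one more than the number of \<open>b\<close>'s in \<open>w\<close>, let \<open>f x\<close> be the number of
  \<open>b\<close>'s among the first \<open>x - 1\<close> letters of \<open>w\<close>, and put \<open>f (x + n) = f x + q\<close>. Comparing the factors of
  \<open>w\<close> with the prefixes of \<open>aw\<close>, \<open>bw\<close> and the suffixes of \<open>wa\<close>, \<open>wb\<close> shows that if \<open>w\<close> is
  bispecial, then \<open>\<delta>(x, y) = f (x + y) - f x - f y\<close> is 0 or 1 whenever none of \<open>x, y, x + y\<close> is divisible
  by \<open>n\<close>. Averaging \<open>\<delta>(x, y)\<close> over \<open>y\<close> gives \<open>0 \<le> x q - n f x \<le> n\<close>; the extreme value \<open>0\<close> forces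
  \<open>\<delta>(x, _) = 0\<close> and the extreme value \<open>n\<close> forces \<open>\<delta>(x, _) = 1\<close>, so by symmetry of \<open>\<delta>\<close> they do not
  both occur. Hence \<open>f x\<close> is \<open>\<lfloor>x q / n\<rfloor>\<close> for all \<open>x\<close>, and \<open>awb\<close> is a lower Christoffel
  word, or it is \<open>\<lceil>x q / n\<rceil> - 1\<close> for all \<open>x\<close>, and \<open>bwa\<close> is an upper one.
\<close>

section \<open>Almost additive functions on residues\<close>

context
  fixes f :: "nat \<Rightarrow> int" and q :: int and n :: nat
  assumes n: "n \<ge> 3"
    and low: "\<And>x y. \<lbrakk>0 < x; 0 < y; x + y < n\<rbrakk> \<Longrightarrow> f (x + y) - f x - f y \<in> {0, 1}"
    and high: "\<And>x y. \<lbrakk>x < n; y < n; n < x + y\<rbrakk> \<Longrightarrow> f (x + y - n) + q - f x - f y \<in> {0, 1}"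
begin

text \<open>The second branch is the extension \<open>f (z + n) = f z + q\<close>. For x + y = n it
  would refer to \<open>f 0\<close>, about which nothing is assumed; hence
  \<open>total_defect\<close> leaves out \<open>y = n - x\<close>.\<close>

private definition defect :: "nat \<Rightarrow> nat \<Rightarrow> int" where
  "defect x y = (if x + y < n then f (x + y) else f (x + y - n) + q) - f x - f y"

private definition total_defect :: "nat \<Rightarrow> int" where
  "total_defect x = (\<Sum>y\<in>{0<..<n} - {n - x}. defect x y)"

private lemma defect_commute: "defect x y = defect y x"
  by (simp add: defect_def add.commute)

private lemma defect_range:
  assumes "x \<in> {0<..<n}" "y \<in> {0<..<n} - {n - x}"
  shows "0 \<le> defect x y" "defect x y \<le> 1"
  using low[of x y] high[of x y] assms by (cases "x + y < n"; force simp: defect_def)+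

text \<open>Translation by x modulo n maps the residues other than 0 and n - x bijectively onto
  those other than 0 and x. So the sums of f cancel except for \<open>f x\<close> and
  \<open>f (n - x)\<close>, and each of the x - 1 values of y with x + y > n contributes one
  q.\<close>

private lemma total_defect_eq:
  assumes x: "x \<in> {0<..<n}"
  shows "total_defect x = int x * q - int n * f x - (q - f x - f (n - x))"
proof -
  have split: "{0<..<n} - {n - x} = {0<..<n - x} \<union> {n - x<..<n}"
    "{0<..<n} = insert x ({0<..<x} \<union> {x<..<n})"
    using x by auto
  have img: "bij_betw (\<lambda>y. x + y) {0<..<n - x} {x<..<n}"
    "bij_betw (\<lambda>y. x + y - n) {n - x<..<n} {0<..<x}"
    by (rule bij_betw_byWitness[where f' = "\<lambda>z. z - x"]; use x in force)
      (rule bij_betw_byWitness[where f' = "\<lambda>z. z + n - x"]; use x in force)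
  have "(\<Sum>y\<in>{0<..<n} - {n - x}. if x + y < n then f (x + y) else f (x + y - n) + q)
      = (\<Sum>y\<in>{0<..<n - x}. f (x + y)) + (\<Sum>y\<in>{n - x<..<n}. f (x + y - n) + q)"
    unfolding split(1) by (subst sum.union_disjoint) (auto intro!: arg_cong2[where f = "(+)"] sum.cong)
  also have "\<dots> = (\<Sum>z\<in>{x<..<n}. f z) + (\<Sum>z\<in>{0<..<x}. f z) + int (x - 1) * q"
    using x sum.reindex_bij_betw[OF img(1), of f] sum.reindex_bij_betw[OF img(2), of f]
    by (simp add: sum.distrib)
  also have "\<dots> = (\<Sum>z\<in>{0<..<n}. f z) - f x + int (x - 1) * q"
    unfolding split(2) by (subst sum.insert) (auto simp: sum.union_disjoint)
  finally have "total_defect x = (\<Sum>z\<in>{0<..<n}. f z) - f x + int (x - 1) * q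
      - (\<Sum>y\<in>{0<..<n} - {n - x}. f x) - (\<Sum>y\<in>{0<..<n} - {n - x}. f y)"
    unfolding total_defect_def defect_def by (simp add: sum_subtractf)
  also have "(\<Sum>y\<in>{0<..<n} - {n - x}. f x) = (int n - 2) * f x"
    using x n by (simp add: of_nat_diff)
  also have "(\<Sum>y\<in>{0<..<n} - {n - x}. f y) = (\<Sum>z\<in>{0<..<n}. f z) - f (n - x)"
    using x by (simp add: sum_diff1)
  finally show ?thesis
    using x by (simp add: of_nat_diff algebra_simps)
qed

private lemma total_defect_range:
  assumes x: "x \<in> {0<..<n}"
  shows "0 \<le> total_defect x" "total_defect x \<le> int n - 2"
proof -
  show "0 \<le> total_defect x"
    unfolding total_defect_def using defect_range[OF x] by (intro sum_nonneg) auto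
  have "total_defect x \<le> (\<Sum>y\<in>{0<..<n} - {n - x}. 1)"
    unfolding total_defect_def using defect_range[OF x] by (intro sum_mono) auto
  then show "total_defect x \<le> int n - 2"
    using x n by (simp add: of_nat_diff)
qed

text \<open>
  Adding the formulas for \<open>x\<close> and \<open>n - x\<close> pins down the unknown value \<open>e = q - f x - f (n - x)\<close>.
\<close>

private lemma deviation_cases:
  assumes x: "x \<in> {0<..<n}"
  obtains e where "e \<in> {0, 1, 2}" "int x * q - int n * f x = total_defect x + e"
    "total_defect x + total_defect (n - x) = (int n - 2) * e"
proof
  let ?e = "q - f x - f (n - x)"
  have x': "n - x \<in> {0<..<n}" using x by auto
  show 1: "int x * q - int n * f x = total_defect x + ?e"
    using total_defect_eq[OF x] by simp
  show 2: "total_defect x + total_defect (n - x) = (int n - 2) * ?e"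
    using total_defect_eq[OF x] total_defect_eq[OF x'] x by (simp add: of_nat_diff algebra_simps)
  \<comment> \<open>Both total defects lie between 0 and n - 2, and n \<ge> 3 makes the factor n - 2
    positive, so it can be cancelled.\<close>
  have "0 \<le> (int n - 2) * ?e" "(int n - 2) * ?e \<le> (int n - 2) * 2"
    using total_defect_range[OF x] total_defect_range[OF x'] unfolding 2[symmetric] by simp_all
  then have "0 \<le> ?e" "?e \<le> 2"
    using n mult_le_cancel_left_pos[of "int n - 2" ?e 2] by (simp_all add: zero_le_mult_iff)
  then show "?e \<in> {0, 1, 2}" by auto
qed

private lemma deviation_range:
  assumes x: "x \<in> {0<..<n}"
  shows "0 \<le> int x * q - int n * f x" "int x * q - int n * f x \<le> int n"
proof -
  obtain e where "e \<in> {0, 1, 2}" "int x * q - int n * f x = total_defect x + e"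
    by (rule deviation_cases[OF x])
  with total_defect_range[OF x]
  show "0 \<le> int x * q - int n * f x" "int x * q - int n * f x \<le> int n" by auto
qed

text \<open>The deviation is a sum of the nonnegative terms \<open>total_defect x\<close> and e, so
  both vanish, and with the total each single defect vanishes. The first conclusion covers the
  partner n - x, which the second has to exclude.\<close>

private lemma deviation_zero:
  assumes x: "x \<in> {0<..<n}" and zero: "int x * q - int n * f x = 0"
  shows "int (n - x) * q - int n * f (n - x) = 0"
    and "y \<in> {0<..<n} - {n - x} \<Longrightarrow> defect x y = 0"
proof -
  have x': "n - x \<in> {0<..<n}" using x by auto
  obtain e where e: "e \<in> {0, 1, 2}" "int x * q - int n * f x = total_defect x + e"
    "total_defect x + total_defect (n - x) = (int n - 2) * e"
    by (rule deviation_cases[OF x])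
  have *: "e = 0" "total_defect x = 0"
    using e zero total_defect_range[OF x] by auto
  then have "total_defect (n - x) = 0" using e by simp
  then show "int (n - x) * q - int n * f (n - x) = 0"
    using total_defect_eq[OF x] total_defect_eq[OF x'] * zero x by simp
  show "defect x y = 0" if "y \<in> {0<..<n} - {n - x}"
    using *(2) that defect_range[OF x] unfolding total_defect_def
    by (subst (asm) sum_nonneg_eq_0_iff) auto
qed

text \<open>The value n is reached only for e = 2 and total defect n - 2, so each of the n - 2
  summands attains its maximum 1.\<close>

private lemma deviation_max:
  assumes x: "x \<in> {0<..<n}" and max: "int x * q - int n * f x = int n"
    and y: "y \<in> {0<..<n} - {n - x}"
  shows "defect x y = 1"
proof -
  obtain e where e: "e \<in> {0, 1, 2}" "int x * q - int n * f x = total_defect x + e"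
    by (rule deviation_cases[OF x])
  have "total_defect x = int n - 2"
    using e max total_defect_range[OF x] by auto
  also have "\<dots> = (\<Sum>y\<in>{0<..<n} - {n - x}. 1)"
    using x n by (simp add: of_nat_diff)
  finally have "(\<Sum>y\<in>{0<..<n} - {n - x}. 1 - defect x y) = 0"
    by (simp add: total_defect_def sum_subtractf)
  then have "1 - defect x y = 0"
    using y defect_range[OF x] by (subst (asm) sum_nonneg_eq_0_iff) auto
  then show ?thesis by simp
qed

lemma almost_additive_deviation:
  "(\<forall>x\<in>{0<..<n}. 0 \<le> int x * q - int n * f x \<and> int x * q - int n * f x < int n) \<or>
   (\<forall>x\<in>{0<..<n}. 0 < int x * q - int n * f x \<and> int x * q - int n * f x \<le> int n)"
proof (rule ccontr)
  assume neg: "\<not> ?thesis"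
  obtain x where x: "x \<in> {0<..<n}" "int x * q - int n * f x = int n"
    using neg deviation_range by (metis order_le_less)
  obtain y where y: "y \<in> {0<..<n}" "int y * q - int n * f y = 0"
    using neg deviation_range by (metis order_le_less)
  show False
  \<comment> \<open>The defect at (x, n - x) is not controlled, so in that case the zero deviation
    is carried over from y to n - y = x.\<close>
  proof (cases "y = n - x")
    case True
    then show False
      using deviation_zero(1)[OF y] x n by simp
  next
    case False
    then have "x \<noteq> n - y" using x(1) y(1) by auto
    with False show False
      using deviation_zero(2)[OF y, of x] deviation_max[OF x, of y] x(1) y(1) defect_commute[of x y]
      by auto
  qed
qed

end

section \<open>Balanced words and letter counts\<close>

lemma count_LA_LB: "count_list u LA + count_list u LB = length u"
proof (induction u)
  case (Cons c u)
  then show ?case by (cases c) auto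
qed simp

lemma int_count_LA: "int (count_list u LA) = int (length u) - int (count_list u LB)"
  using count_LA_LB[of u] by linarith

text \<open>For words of equal length the differences of the a-counts and of the b-counts agree up
  to sign. The b's are the convenient ones, since their prefix counts in lower Christoffel words are
  floors.\<close>

lemma balanced_LB_count:
  "balanced w \<longleftrightarrow>
     (\<forall>u v. sublist u w \<longrightarrow> sublist v w \<longrightarrow> length u = length v \<longrightarrow>
        \<bar>int (count_list u LB) - int (count_list v LB)\<bar> \<le> 1)"
  unfolding balanced_def by (auto simp: int_count_LA abs_minus_commute)

lemma balanced_sublist: "balanced w \<Longrightarrow> sublist u w \<Longrightarrow> balanced u"
  unfolding balanced_def by (meson sublist_order.order_trans)

lemma balancedI:
  assumes "\<And>u. sublist u w \<Longrightarrow>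
    m (length u) \<le> int (count_list u LB) \<and> int (count_list u LB) \<le> m (length u) + 1"
  shows "balanced w"
  unfolding balanced_LB_count
proof (intro allI impI)
  fix u v assume "sublist u w" "sublist v w" "length u = length v"
  then show "\<bar>int (count_list u LB) - int (count_list v LB)\<bar> \<le> 1"
    using assms[of u] assms[of v] by auto
qed

lemma sublist_take_drop: "sublist (take k (drop i w)) w"
  by (metis sublist_drop sublist_order.order_trans sublist_take)

lemma sublistE_take_drop:
  assumes "sublist u w"
  obtains i where "i + length u \<le> length w" "u = take (length u) (drop i w)"
proof -
  obtain ps ss where "w = ps @ u @ ss"
    using assms by (auto simp: sublist_def)
  then show thesis by (intro that[of "length ps"]) auto
qed

lemma count_list_take_drop:
  "int (count_list (take k (drop i w)) c)
     = int (count_list (take (i + k) w) c) - int (count_list (take i w) c)"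
  by (simp add: take_add)

lemma count_list_drop:
  "int (count_list (drop i w) c) = int (count_list w c) - int (count_list (take i w) c)"
proof -
  have "count_list w c = count_list (take i w) c + count_list (drop i w) c"
    by (metis append_take_drop_id count_list_append)
  then show ?thesis by simp
qed

lemma eq_if_LB_counts_eq:
  assumes "length v = length w"
    and "\<And>i. i \<le> length w \<Longrightarrow> count_list (take i v) LB = count_list (take i w) LB"
  shows "v = w"
proof (rule nth_equalityI)
  fix i assume i: "i < length v"
  then have "count_list (take (Suc i) v) LB = count_list (take (Suc i) w) LB"
    "count_list (take i v) LB = count_list (take i w) LB"
    using assms by auto
  then have "v ! i = LB \<longleftrightarrow> w ! i = LB"
    using i assms(1) by (simp add: take_Suc_conv_app_nth split: if_splits)
  then show "v ! i = w ! i"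
    by (metis letter.exhaust)
qed (fact assms(1))

section \<open>Exchanging the two letters\<close>

fun swap_letter :: "letter \<Rightarrow> letter" where
  "swap_letter LA = LB"
| "swap_letter LB = LA"

lemma swap_letter_idem [simp]: "swap_letter (swap_letter c) = c"
  by (cases c) auto

lemma map_swap_swap [simp]: "map swap_letter (map swap_letter w) = w"
  by (simp add: map_idI)

lemma count_swap:
  "count_list (map swap_letter u) LA = count_list u LB"
  "count_list (map swap_letter u) LB = count_list u LA"
proof (induction u)
  case (Cons c u)
  { case 1 show ?case using Cons by (cases c) auto }
  { case 2 show ?case using Cons by (cases c) auto }
qed simp_all

lemma balanced_map_swap: "balanced w \<Longrightarrow> balanced (map swap_letter w)"
  unfolding balanced_LB_count
proof (intro allI impI)
  fix u v
  assume w: "\<forall>u v. sublist u w \<longrightarrow> sublist v w \<longrightarrow> length u = length v \<longrightarrow>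
        \<bar>int (count_list u LB) - int (count_list v LB)\<bar> \<le> 1"
    and "sublist u (map swap_letter w)" "sublist v (map swap_letter w)" "length u = length v"
  moreover from this have "sublist (map swap_letter u) w" "sublist (map swap_letter v) w"
    by (metis map_mono_sublist map_swap_swap)+
  ultimately have "\<bar>int (count_list (map swap_letter u) LB) - int (count_list (map swap_letter v) LB)\<bar> \<le> 1"
    by simp
  then show "\<bar>int (count_list u LB) - int (count_list v LB)\<bar> \<le> 1"
    using \<open>length u = length v\<close> by (simp add: count_swap int_count_LA)
qed

lemma bispecial_iff_balanced:
  "bispecial w \<longleftrightarrow> balanced (LA # w) \<and> balanced (LB # w) \<and> balanced (w @ [LA]) \<and> balanced (w @ [LB])"
  unfolding bispecial_def left_special_def right_special_def St_def
  using balanced_sublist[of "LA # w" w] by (auto simp: sublist_Cons_right)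

lemma bispecial_map_swap: "bispecial w \<Longrightarrow> bispecial (map swap_letter w)"
  unfolding bispecial_iff_balanced
  using balanced_map_swap[of "LA # w"] balanced_map_swap[of "LB # w"]
    balanced_map_swap[of "w @ [LA]"] balanced_map_swap[of "w @ [LB]"] by simp

text \<open>Both words compare the same multiples of p modulo p + q, with opposite letters. This
  reduces everything about upper words to lower ones.\<close>

lemma upper_eq_swap_lower:
  assumes "p > 0" "q > 0"
  shows "upper_christoffel p q = map swap_letter (lower_christoffel q p)"
proof (rule nth_equalityI)
  fix j assume "j < length (upper_christoffel p q)"
  then have j: "j < p + q" by simp
  then show "upper_christoffel p q ! j = map swap_letter (lower_christoffel q p) ! j"
    using assms upper_christoffel_nth[of p q "Suc j"] lower_christoffel_nth[of q p "Suc j"]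
    by (cases "lower_christoffel q p ! j") (auto simp: add.commute)
qed simp

section \<open>Prefix counts of Christoffel words\<close>

text \<open>A step of size q < n passes at most one multiple of n, and it passes one exactly when
  the residue drops. So each b of a lower Christoffel word marks one multiple of n.\<close>

lemma Suc_mult_div:
  fixes i q n :: nat
  assumes "0 < q" "q < n"
  shows "(Suc i * q) div n = (if (Suc i * q) mod n > (i * q) mod n then 0 else 1) + (i * q) div n"
proof -
  define r d where "r = (i * q) mod n" and "d = (i * q) div n"
  have r: "r < n" and eq: "Suc i * q = n * d + (r + q)"
    using assms by (simp_all add: r_def d_def)
  show ?thesis
  proof (cases "r + q < n")
    case True
    then have "(Suc i * q) div n = d" "(Suc i * q) mod n = r + q"
      unfolding eq using assms by simp_all
    then show ?thesis using assms by (simp flip: r_def d_def)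
  next
    case False
    then have "Suc i * q = n * Suc d + (r + q - n)" "r + q - n < n"
      using eq r assms by auto
    then have "(Suc i * q) div n = Suc d" "(Suc i * q) mod n = r + q - n"
      by (metis add.right_neutral div_less div_mult_self4 less_nat_zero_code mod_less mod_mult_self4 mult_is_0
          add.commute not_gr_zero)+
    then show ?thesis using assms r by (simp flip: r_def d_def)
  qed
qed

lemma count_take_lower_christoffel:
  assumes "p > 0" "q > 0" "i \<le> p + q"
  shows "count_list (take i (lower_christoffel p q)) LB = (i * q) div (p + q)"
  using assms(3)
proof (induction i)
  case (Suc i)
  have "lower_christoffel p q ! i =
      (if (Suc i * q) mod (p + q) > (i * q) mod (p + q) then LA else LB)"
    using Suc.prems by (simp add: lower_christoffel_def del: upt_Suc)
  then show ?case
    using Suc assms Suc_mult_div[of q "p + q" i] by (simp add: take_Suc_conv_app_nth del: mult_Suc)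
qed simp

text \<open>Prefix counts of b determine a word; those of length 0 and p + q agree by the
  assumptions on length and count. The shift x - 1 accounts for the leading a.\<close>

lemma lower_christoffel_eqI:
  assumes "p > 0" "q > 0" "length w + 2 = p + q" "count_list w LB + 1 = q"
    and "\<And>x. x \<in> {0<..<p + q} \<Longrightarrow> count_list (take (x - 1) w) LB = (x * q) div (p + q)"
  shows "LA # w @ [LB] = lower_christoffel p q"
proof (rule eq_if_LB_counts_eq)
  fix i assume "i \<le> length (lower_christoffel p q)"
  then have i: "i \<le> p + q" by simp
  consider "i = 0" | "i \<in> {0<..<p + q}" | "i = p + q"
    using i by fastforce
  then have "count_list (take i (LA # w @ [LB])) LB = (i * q) div (p + q)"
  proof cases
    case 2
    then show ?thesis
      using assms(3) assms(5)[of i] by (auto simp: take_Cons')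
  qed (use assms in auto)
  then show "count_list (take i (LA # w @ [LB])) LB = count_list (take i (lower_christoffel p q)) LB"
    using count_take_lower_christoffel[OF assms(1,2) i] by simp
qed (use assms in simp)

section \<open>Interiors of Christoffel words are bispecial\<close>

lemma div_add_bounds:
  fixes a b n :: nat
  shows "a div n + b div n \<le> (a + b) div n" "n > 0 \<Longrightarrow> (a + b) div n \<le> a div n + b div n + 1"
proof -
  have *: "(a + b) div n = a div n + b div n + (a mod n + b mod n) div n"
    by (rule div_add1_eq)
  show "a div n + b div n \<le> (a + b) div n"
    using * by simp
  assume "n > 0"
  then have "a mod n + b mod n < 2 * n"
    using mod_less_divisor[of n a] mod_less_divisor[of n b] by linarith
  then have "(a mod n + b mod n) div n < 2"
    by (simp add: div_less_iff_less_mult \<open>n > 0\<close>)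
  with * show "(a + b) div n \<le> a div n + b div n + 1" by linarith
qed

text \<open>A factor count is a difference of two floors. With \<kappa> = kq/n, the first range
  starts at the floor of \<kappa>, the second ends at its ceiling, obtained from the complementary
  length n - k. They differ when \<kappa> is an integer: the first then leaves room for an
  additional b, the second for one b fewer.\<close>

lemma sublist_lower_christoffel_count:
  assumes "p > 0" "q > 0" "sublist u (lower_christoffel p q)"
  defines "n \<equiv> p + q" and "k \<equiv> length u" and "c \<equiv> int (count_list u LB)"
  shows "int (k * q div n) \<le> c \<and> c \<le> int (k * q div n) + 1"
    and "int q - int ((n - k) * q div n) - 1 \<le> c \<and> c \<le> int q - int ((n - k) * q div n)"
proof -
  obtain i where i: "i + k \<le> n" and u: "u = take k (drop i (lower_christoffel p q))"
    unfolding n_def k_def by (rule sublistE_take_drop[OF assms(3)]) simp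
  have c: "c = int ((i + k) * q div n) - int (i * q div n)"
    using count_take_lower_christoffel[OF assms(1,2), of "i + k"]
      count_take_lower_christoffel[OF assms(1,2), of i] i
    unfolding c_def by (subst u) (simp add: count_list_take_drop n_def)
  have n: "n > 0" using assms by (simp add: n_def)
  show "int (k * q div n) \<le> c \<and> c \<le> int (k * q div n) + 1"
    using div_add_bounds[where a = "i * q" and b = "k * q" and n = n] n by (simp add: c distrib_right)
  have "(i + k) * q + (n - k) * q = n * q + i * q"
    using i by (simp flip: distrib_right)
  then have "((i + k) * q + (n - k) * q) div n = q + i * q div n"
    using n by simp
  then show "int q - int ((n - k) * q div n) - 1 \<le> c \<and> c \<le> int q - int ((n - k) * q div n)"
    using div_add_bounds[where a = "(i + k) * q" and b = "(n - k) * q" and n = n] n by (simp add: c)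
qed

lemma bispecial_if_lower_christoffel:
  assumes "p > 0" "q > 0" "lower_christoffel p q = LA # w @ [LB]"
  shows "bispecial w"
proof -
  let ?n = "p + q"
  let ?L = "LA # w @ [LB]"
  have len: "length w + 2 = ?n"
    using arg_cong[OF assms(3), of length] by simp
  note bounds = sublist_lower_christoffel_count[OF assms(1,2), unfolded assms(3)]
  note prefix_count = count_take_lower_christoffel[OF assms(1,2), unfolded assms(3)]
  have "balanced ?L"
    using bounds(1) by (intro balancedI[where m = "\<lambda>k. int (k * q div ?n)"]) blast
  moreover have "sublist (LA # w) ?L" "sublist (w @ [LB]) ?L"
    by (auto simp: sublist_Cons_right intro: prefix_imp_sublist)
  ultimately have "balanced (LA # w)" "balanced (w @ [LB])"
    using balanced_sublist by blast+
  moreover have "balanced (LB # w)"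
  proof (intro balancedI[where m = "\<lambda>k. int (k * q div ?n)"])
    fix u assume "sublist u (LB # w)"
    then consider "sublist u w" | "u = []" | u' where "u = LB # u'" "prefix u' w"
      by (auto simp: sublist_Cons_right prefix_Cons)
    then show "int (length u * q div ?n) \<le> int (count_list u LB) \<and>
        int (count_list u LB) \<le> int (length u * q div ?n) + 1"
    proof cases
      case 1
      then have "sublist u ?L"
        by (auto simp: sublist_Cons_right sublist_append)
      then show ?thesis by (rule bounds(1))
    next
      case 3
      then obtain v where v: "w = u' @ v" by (auto simp: prefix_def)
      \<comment> \<open>Prefixes of the Christoffel word attain the floor exactly, so turning the
        leading a into b gives at most the floor plus 1.\<close>
      have "count_list (take (length u) ?L) LB = length u * q div ?n"
        using len by (intro prefix_count) (simp add: 3 v)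
      then show ?thesis by (simp add: 3 v)
    qed simp
  qed
  moreover have "balanced (w @ [LA])"
  proof (intro balancedI[where m = "\<lambda>k. int q - int ((?n - k) * q div ?n) - 1"])
    fix u assume "sublist u (w @ [LA])"
    then consider "sublist u w" | "u = []" | u' where "u = u' @ [LA]" "suffix u' w"
      by (auto simp: sublist_append suffix_snoc sublist_Cons_right prefix_Cons)
    then show "int q - int ((?n - length u) * q div ?n) - 1 \<le> int (count_list u LB) \<and>
        int (count_list u LB) \<le> int q - int ((?n - length u) * q div ?n) - 1 + 1"
    proof cases
      case 1
      then have "sublist u ?L"
        by (auto simp: sublist_Cons_right sublist_append)
      then show ?thesis using bounds(2) by simp
    next
      case 2
      then show ?thesis using assms by simp
    next
      case 3
      then obtain v where v: "w = v @ u'" by (auto simp: suffix_def)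
      have "count_list (take ?n ?L) LB = ?n * q div ?n"
        by (intro prefix_count) simp
      then have "count_list w LB + 1 = q"
        using len assms(1) by simp
      \<comment> \<open>Cutting off the suffix of length |u| leaves the prefix
        \<open>LA # v\<close>, so that suffix attains the upper bound of the second range; turning
        its last b into a gives the lower bound.\<close>
      moreover have "count_list (take (?n - length u) ?L) LB = (?n - length u) * q div ?n"
        by (intro prefix_count) simp
      moreover have "?n - length u = Suc (length v)"
        using len by (simp add: 3 v)
      ultimately show ?thesis
        by (simp add: 3 v)
    qed
  qed
  ultimately show ?thesis
    by (simp add: bispecial_iff_balanced)
qed

text \<open>The residues start with a rise from 0 to q and end with a drop to 0, which forces both
  outer letters.\<close>

lemma christoffel_ends:
  assumes "p > 0" "q > 0" "lower_christoffel p q = [x] @ w @ [y]"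
  shows "x = LA" "y = LB"
proof -
  have len: "p + q = length w + 2"
    using arg_cong[OF assms(3), of length] by simp
  show "x = LA"
    using lower_christoffel_nth(1)[of p q 1] assms by simp
  have "lower_christoffel p q ! (p + q - 1) = y"
    using assms(3) len by (simp add: nth_append)
  moreover have "(p + q - 1) * q mod (p + q) > 0"
    using consecutive_residues_differ[of q "p + q" "p + q"] assms by simp
  ultimately show "y = LB"
    using lower_christoffel_nth(2)[of p q "p + q"] assms by simp
qed

lemma bispecial_if_christoffel:
  assumes "christoffel ([x] @ w @ [y])"
  shows "bispecial w"
proof -
  have lower: "bispecial v" if "p > 0" "q > 0" "lower_christoffel p q = [x'] @ v @ [y']" for p q x' v y'
    using bispecial_if_lower_christoffel[of p q v] christoffel_ends[OF that] that by simp
  from assms obtain p q where pq: "p > 0" "q > 0"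
    and "[x] @ w @ [y] = lower_christoffel p q \<or> [x] @ w @ [y] = upper_christoffel p q"
    unfolding christoffel_def by blast
  then show ?thesis
  proof (elim disjE)
    assume "[x] @ w @ [y] = upper_christoffel p q"
    then have "map swap_letter ([x] @ w @ [y]) = lower_christoffel q p"
      by (simp only: upper_eq_swap_lower[OF pq] map_swap_swap)
    then have "bispecial (map swap_letter w)"
      using lower[OF pq(2,1), of "swap_letter x" "map swap_letter w" "swap_letter y"] by simp
    from bispecial_map_swap[OF this] show ?thesis by (simp only: map_swap_swap)
  qed (use lower pq in metis)
qed

section \<open>Bispecial words are interiors of Christoffel words\<close>

lemma bispecial_deviation:
  assumes "bispecial w" "w \<noteq> []"
  defines "f \<equiv> \<lambda>x. int (count_list (take (x - 1) w) LB)"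
    and "q \<equiv> int (count_list w LB) + 1" and "n \<equiv> length w + 2"
  shows "(\<forall>x\<in>{0<..<n}. 0 \<le> int x * q - int n * f x \<and> int x * q - int n * f x < int n) \<or>
         (\<forall>x\<in>{0<..<n}. 0 < int x * q - int n * f x \<and> int x * q - int n * f x \<le> int n)"
proof (rule almost_additive_deviation)
  have bal: "balanced (c # w)" "balanced (w @ [c])" for c
    using assms(1) by (cases c; simp add: bispecial_iff_balanced)+
  show "n \<ge> 3" using assms(2) by (cases w) (auto simp: n_def)
  show "f (x + y) - f x - f y \<in> {0, 1}" if xy: "0 < x" "0 < y" "x + y < n" for x y
  proof -
    \<comment> \<open>The factor u, of length y, is compared with the equally long prefixes av and
      bv. Being within 1 of both counts means exceeding the count of v by 0 or 1.\<close>
    define u v where "u = take y (drop (x - 1) w)" and "v = take (y - 1) w"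
    have sub: "sublist u (c # w)" "sublist (c # v) (c # w)" for c
      unfolding u_def v_def sublist_Cons_right
      by (simp_all add: sublist_take_drop take_is_prefix)
    have "length u = length (c # v)" for c
      using xy by (simp add: u_def v_def n_def)
    then have "\<bar>int (count_list u LB) - int (count_list (c # v) LB)\<bar> \<le> 1" for c
      using bal(1)[of c] sub[of c] unfolding balanced_LB_count by blast
    from this[of LA] this[of LB] have "int (count_list u LB) - int (count_list v LB) \<in> {0, 1}"
      by auto
    moreover have "int (count_list u LB) = f (x + y) - f x"
      using xy by (simp add: u_def f_def count_list_take_drop)
    ultimately show ?thesis by (simp add: v_def f_def)
  qed
  show "f (x + y - n) + q - f x - f y \<in> {0, 1}" if xy: "x < n" "y < n" "n < x + y" for x y
  proof -
    \<comment> \<open>The mirrored comparison: u ends after x - 1 letters and has the length n - y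
      of the suffixes va and vb. The required expression is 1 minus the difference of the counts of
      u and v.\<close>
    define u v where "u = take (n - y) (drop (x + y - n - 1) w)" and "v = drop (y - 1) w"
    have sub: "sublist u (w @ [c])" "sublist (v @ [c]) (w @ [c])" for c
      unfolding u_def v_def
      by (simp add: sublist_append sublist_take_drop) (simp add: suffix_drop suffix_imp_sublist)
    have "length u = length (v @ [c])" for c
      using xy by (simp add: u_def v_def n_def)
    then have "\<bar>int (count_list u LB) - int (count_list (v @ [c]) LB)\<bar> \<le> 1" for c
      using bal(2)[of c] sub[of c] unfolding balanced_LB_count by blast
    from this[of LA] this[of LB] have "int (count_list u LB) - int (count_list v LB) \<in> {0, 1}"
      by auto
    moreover have "int (count_list u LB) = f x - f (x + y - n)"
      using xy by (simp add: u_def f_def count_list_take_drop)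
    moreover have "int (count_list v LB) = q - 1 - f y"
      by (simp add: v_def f_def q_def count_list_drop)
    ultimately show ?thesis by auto
  qed
qed

lemma lower_christoffel_if_deviation:
  assumes "\<And>x. x \<in> {0<..<length w + 2} \<Longrightarrow>
      0 \<le> int x * (int (count_list w LB) + 1) - int (length w + 2) * int (count_list (take (x - 1) w) LB) \<and>
      int x * (int (count_list w LB) + 1) - int (length w + 2) * int (count_list (take (x - 1) w) LB)
        < int (length w + 2)"
  shows "LA # w @ [LB] = lower_christoffel (count_list w LA + 1) (count_list w LB + 1)"
proof (rule lower_christoffel_eqI)
  let ?q = "count_list w LB + 1" and ?n = "count_list w LA + 1 + (count_list w LB + 1)"
  show len: "length w + 2 = ?n" by (simp flip: count_LA_LB)
  fix x assume "x \<in> {0<..<?n}"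
  then have "x \<in> {0<..<length w + 2}" unfolding len .
  from assms[OF this] have "int (?n * count_list (take (x - 1) w) LB) \<le> int (x * ?q)"
    "int (x * ?q) < int (?n * (count_list (take (x - 1) w) LB + 1))"
    unfolding len by (simp_all add: algebra_simps)
  then show "count_list (take (x - 1) w) LB = x * ?q div ?n"
    unfolding of_nat_le_iff of_nat_less_iff
    by (intro div_nat_eqI[symmetric]) (simp_all add: mult.commute)
qed auto

lemma christoffel_if_bispecial:
  assumes "bispecial w"
  shows "\<exists>x y. christoffel ([x] @ w @ [y])"
proof (cases "w = []")
  case True
  \<comment> \<open>The empty word gives n = 2, too small for the averaging argument; p = q = 1
    serves directly.\<close>
  have "christoffel [LA, LB]"
    unfolding christoffel_def lower_christoffel_def
    by (rule exI[of _ 1], rule exI[of _ 1]) (simp add: upt_rec)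
  then show ?thesis using True by auto
next
  case False
  from bispecial_deviation[OF assms False] show ?thesis
  proof
    assume "\<forall>x\<in>{0<..<length w + 2}.
      0 \<le> int x * (int (count_list w LB) + 1) - int (length w + 2) * int (count_list (take (x - 1) w) LB) \<and>
      int x * (int (count_list w LB) + 1) - int (length w + 2) * int (count_list (take (x - 1) w) LB)
        < int (length w + 2)"
    then have "LA # w @ [LB] = lower_christoffel (count_list w LA + 1) (count_list w LB + 1)"
      by (intro lower_christoffel_if_deviation) blast
    then have "christoffel ([LA] @ w @ [LB])"
      unfolding christoffel_def by (metis append_Cons append_Nil zero_less_Suc Suc_eq_plus1)
    then show ?thesis by blast
  next
    let ?w = "map swap_letter w"
    assume *: "\<forall>x\<in>{0<..<length w + 2}.
      0 < int x * (int (count_list w LB) + 1) - int (length w + 2) * int (count_list (take (x - 1) w) LB) \<and>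
      int x * (int (count_list w LB) + 1) - int (length w + 2) * int (count_list (take (x - 1) w) LB)
        \<le> int (length w + 2)"
    have "LA # ?w @ [LB] = lower_christoffel (count_list ?w LA + 1) (count_list ?w LB + 1)"
    proof (rule lower_christoffel_if_deviation)
      fix x assume "x \<in> {0<..<length ?w + 2}"
      then have x: "x \<in> {0<..<length w + 2}" by simp
      \<comment> \<open>Exchanging the letters replaces q by n - q and a deviation d by n - d, so
        the range 0 < d \<le> n becomes the one for lower Christoffel words.\<close>
      have "int x * (int (count_list ?w LB) + 1)
            - int (length ?w + 2) * int (count_list (take (x - 1) ?w) LB)
          = int (length w + 2) - (int x * (int (count_list w LB) + 1)
            - int (length w + 2) * int (count_list (take (x - 1) w) LB))"
        using x by (auto simp: take_map count_swap int_count_LA of_nat_diff min_absorb2 algebra_simps)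
      with *[rule_format, OF x]
      show "0 \<le> int x * (int (count_list ?w LB) + 1)
            - int (length ?w + 2) * int (count_list (take (x - 1) ?w) LB) \<and>
          int x * (int (count_list ?w LB) + 1)
            - int (length ?w + 2) * int (count_list (take (x - 1) ?w) LB) < int (length ?w + 2)"
        by simp
    qed
    then have "map swap_letter (LA # ?w @ [LB]) = upper_christoffel (count_list ?w LB + 1) (count_list ?w LA + 1)"
      by (simp add: upper_eq_swap_lower)
    then have "[LB] @ w @ [LA] = upper_christoffel (count_list ?w LB + 1) (count_list ?w LA + 1)"
      using map_swap_swap[of w] by (simp del: map_swap_swap map_map)
    then have "christoffel ([LB] @ w @ [LA])"
      unfolding christoffel_def by (metis zero_less_Suc Suc_eq_plus1)
    then show ?thesis by blast
  qed
qed

theorem theorem3p11: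
  shows "(\<forall>w :: word. bispecial w \<longleftrightarrow> (\<exists>x y. christoffel ([x] @ w @ [y]))) \<and>
         {w :: word. bispecial w} = {w. \<exists>x y. christoffel ([x] @ w @ [y])}"
  using bispecial_if_christoffel christoffel_if_bispecial by blast

end
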